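(* Let $X$ be a finite set of alternatives with $|X|=m\geq 4$ and $N=\{1,\dots,n\}$ with $n\geq 3$. Let $\mathbf{D}$ be the set of profiles $u\in L(X)^N$ for which it is not true that $u(i)[1:2]=u(j)[1:2]$ for all individuals $i,j$. Then any social choice correspondence $G$ on $L(X)^N$ satisfying balancedness and top-2-only is constant on $\mathbf{D}$.
   Context: An ordering on $X$ is a strict linear order on $X$; $L(X)$ is the set of all orderings; for an ordering $r$, $r[1:2]$ denotes the unordered set of the alternatives in the top two ranks of $r$. A profile is $u=(u(1),\dots,u(n))\in L(X)^N$. A social choice correspondence is a map $G$ from $L(X)^N$ to non-empty subsets of $X$. $G$ satisfies top-2-only if $G(u)=G(u^* )$ whenever $u(i)[1:2]=u^*(i)[1:2]$ for all individuals $i$. Profile $v$ is constructed from $u$ by transposition pair $(x,y)$ via individuals $i$ and $j$ if at $u$, $x$ is immediately above $y$ in $u(i)$ and $y$ is immediately above $x$ in $u(j)$, and $v$ equals $u$ except that $x$ and $y$ are swapped in the orderings of $i$ and $j$. $G$ satisfies balancedness if $G(v)=G(u)$ whenever $v$ is constructed from $u$ by some transposition pair via some two individuals. *)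

theory Defs
  imports "HOL-Combinatorics.Transposition" "HOL-Library.FuncSet"
begin

text \<open>An ordering is a strict linear order given as a relation on \<open>X\<close>;
  \<open>(x, y) \<in> r\<close> means that \<open>x\<close> is ranked above \<open>y\<close>.
  Since \<open>strict_linear_order_on\<close> does not confine the relation to \<open>X\<close>, this is required
  separately.\<close>

definition orderings :: "'a set \<Rightarrow> 'a rel set" where
  "orderings X = {r. r \<subseteq> X \<times> X \<and> strict_linear_order_on X r}"

text \<open>Individuals are \<open>1, \<dots>, n\<close>. The extensional function space makes
  profiles that agree on all individuals equal.\<close>

definition profiles :: "'a set \<Rightarrow> nat \<Rightarrow> (nat \<Rightarrow> 'a rel) set" where
  "profiles X n = ({1..n} \<rightarrow>\<^sub>E orderings X)"

text \<open>The number of alternatives above \<open>x\<close> is 0 for rank one and 1 for rank two.\<close>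

definition top2 :: "'a set \<Rightarrow> 'a rel \<Rightarrow> 'a set" where
  "top2 X r = {x \<in> X. card {y \<in> X. (y, x) \<in> r} < 2}"

definition immediately_above :: "'a rel \<Rightarrow> 'a \<Rightarrow> 'a \<Rightarrow> bool" where
  "immediately_above r x y \<longleftrightarrow> (x, y) \<in> r \<and> (\<nexists>z. (x, z) \<in> r \<and> (z, y) \<in> r)"

definition swap_alternatives :: "'a \<Rightarrow> 'a \<Rightarrow> 'a rel \<Rightarrow> 'a rel" where
  "swap_alternatives x y r = map_prod (transpose x y) (transpose x y) ` r"

text \<open>The individuals \<open>i\<close> and \<open>j\<close> below are automatically distinct, and so are
  \<open>x\<close> and \<open>y\<close>, because each ordering is asymmetric.\<close>

definition transposition_pair ::
    "nat \<Rightarrow> (nat \<Rightarrow> 'a rel) \<Rightarrow> 'a \<Rightarrow> 'a \<Rightarrow> nat \<Rightarrow> nat \<Rightarrow> (nat \<Rightarrow> 'a rel) \<Rightarrow> bool" where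
  "transposition_pair n u x y i j v \<longleftrightarrow>
     i \<in> {1..n} \<and> j \<in> {1..n} \<and>
     immediately_above (u i) x y \<and> immediately_above (u j) y x \<and>
     v = u(i := swap_alternatives x y (u i), j := swap_alternatives x y (u j))"

text \<open>Correspondences are total functions of which only the values on profiles matter.\<close>

definition social_choice_correspondence ::
    "'a set \<Rightarrow> nat \<Rightarrow> ((nat \<Rightarrow> 'a rel) \<Rightarrow> 'a set) \<Rightarrow> bool" where
  "social_choice_correspondence X n G \<longleftrightarrow> (\<forall>u \<in> profiles X n. G u \<noteq> {} \<and> G u \<subseteq> X)"

definition top2_only :: "'a set \<Rightarrow> nat \<Rightarrow> ((nat \<Rightarrow> 'a rel) \<Rightarrow> 'a set) \<Rightarrow> bool" where
  "top2_only X n G \<longleftrightarrow>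
     (\<forall>u \<in> profiles X n. \<forall>u' \<in> profiles X n.
        (\<forall>i \<in> {1..n}. top2 X (u i) = top2 X (u' i)) \<longrightarrow> G u = G u')"

definition balanced :: "'a set \<Rightarrow> nat \<Rightarrow> ((nat \<Rightarrow> 'a rel) \<Rightarrow> 'a set) \<Rightarrow> bool" where
  "balanced X n G \<longleftrightarrow>
     (\<forall>u \<in> profiles X n. \<forall>v \<in> profiles X n. \<forall>x y i j.
        transposition_pair n u x y i j v \<longrightarrow> G v = G u)"

definition disagreement_profiles :: "'a set \<Rightarrow> nat \<Rightarrow> (nat \<Rightarrow> 'a rel) set" where
  "disagreement_profiles X n =
     {u \<in> profiles X n. \<not> (\<forall>i \<in> {1..n}. \<forall>j \<in> {1..n}. top2 X (u i) = top2 X (u j))}"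

end

theory Submission
  imports Defs
begin

text \<open>By top-2-only, \<open>G\<close> depends only on the edge \<open>u(i)[1:2]\<close> of the complete graph on \<open>X\<close> held by
  each individual. Balancedness then lets \<open>i\<close> replace an endpoint \<open>x\<close> of her edge by \<open>y\<close> whenever
  somebody else's edge contains both or neither of \<open>x\<close>, \<open>y\<close> (his transposition is invisible), and lets
  \<open>i\<close> and \<open>j\<close> trade \<open>x\<close> for \<open>y\<close> and \<open>y\<close> for \<open>x\<close> simultaneously. If no such witness exists, every other
  edge contains exactly one of \<open>x\<close>, \<open>y\<close>, and a detour of at most three moves involving two further
  individuals achieves the replacement, provided that the edges disagree both before and after.
  Changing individual edges one at a time without passing through unanimity connects
  any two disagreement profiles.\<close>

section \<open>Orderings as lists\<close>

text \<open>With the best alternative first, an adjacent pair in the ranking is a pair of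
  neighbouring entries, so transpositions and top-two sets can be read off from the list.\<close>

fun list_order :: "'a list \<Rightarrow> 'a rel" where
  "list_order [] = {}"
| "list_order (x # xs) = {x} \<times> set xs \<union> list_order xs"

lemma list_order_subset: "list_order xs \<subseteq> set xs \<times> set xs"
  by (induction xs) auto

lemma list_order_append:
  "list_order (xs @ ys) = list_order xs \<union> set xs \<times> set ys \<union> list_order ys"
  by (induction xs) auto

lemma trans_list_order: "distinct xs \<Longrightarrow> trans (list_order xs)"
proof (induction xs)
  case (Cons x xs)
  then show ?case using list_order_subset[of xs] by (auto simp: trans_def)
qed simp

lemma irrefl_list_order: "distinct xs \<Longrightarrow> irrefl (list_order xs)"
proof (induction xs)
  case (Cons x xs)
  then show ?case using list_order_subset[of xs] by (auto simp: irrefl_def)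
qed (simp add: irrefl_def)

lemma total_list_order: "total_on (set xs) (list_order xs)"
  by (induction xs) (auto simp: total_on_def)

lemma list_order_in_orderings:
  assumes "distinct xs" "set xs = X"
  shows "list_order xs \<in> orderings X"
  using trans_list_order irrefl_list_order total_list_order[of xs] list_order_subset[of xs] assms
  by (auto simp: orderings_def strict_linear_order_on_def)

lemma map_prod_list_order:
  "map_prod f f ` list_order xs = list_order (map f xs)"
  by (induction xs) (auto simp: image_Un map_prod_def image_iff split: prod.splits)

lemma immediately_above_list_order:
  assumes "distinct (p @ x # y # q)"
  shows "immediately_above (list_order (p @ x # y # q)) x y"
  using assms list_order_subset[of p] list_order_subset[of q]
  by (auto simp: immediately_above_def list_order_append)

lemma swap_list_order:
  assumes "distinct (p @ x # y # q)"
  shows "swap_alternatives x y (list_order (p @ x # y # q)) = list_order (p @ y # x # q)"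
proof -
  have "map (transpose x y) p = p" "map (transpose x y) q = q"
    using assms by (auto intro!: map_idI simp: transpose_def)
  then show ?thesis by (simp add: swap_alternatives_def map_prod_list_order)
qed

text \<open>Counting the alternatives above: \<open>a\<close> has none, \<open>b\<close> has only
  \<open>a\<close>, and any other \<open>c\<close> has at least \<open>a\<close> and
  \<open>b\<close>.\<close>

lemma top2_eqI:
  assumes X: "finite X" "a \<in> X" "b \<in> X" "a \<noteq> b"
    and first: "\<And>y. (y, a) \<notin> r" and second: "\<And>y. y \<in> X \<Longrightarrow> (y, b) \<in> r \<longleftrightarrow> y = a"
    and rest: "\<And>c. c \<in> X \<Longrightarrow> c \<noteq> a \<Longrightarrow> c \<noteq> b \<Longrightarrow> (a, c) \<in> r \<and> (b, c) \<in> r"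
  shows "top2 X r = {a, b}"
proof -
  have "\<not> card {y \<in> X. (y, c) \<in> r} < 2" if "c \<in> X" "c \<noteq> a" "c \<noteq> b" for c
  proof -
    have "card {a, b} \<le> card {y \<in> X. (y, c) \<in> r}"
      using X rest[OF that] by (intro card_mono) auto
    then show ?thesis using X(4) by simp
  qed
  moreover have "{y \<in> X. (y, a) \<in> r} = {}" "{y \<in> X. (y, b) \<in> r} = {a}"
    using X first second by auto
  then have "card {y \<in> X. (y, a) \<in> r} < 2" "card {y \<in> X. (y, b) \<in> r} < 2"
    by (metis card.empty zero_less_numeral, simp)
  ultimately show ?thesis using X unfolding top2_def by blast
qed

lemma top2_list_order:
  assumes "distinct (a # b # q)" "set (a # b # q) = X"
  shows "top2 X (list_order (a # b # q)) = {a, b}"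
  by (rule top2_eqI) (use assms list_order_subset[of q] in auto)

section \<open>Edge profiles\<close>

definition edges :: "'a set \<Rightarrow> 'a set set" where
  "edges X = {s. s \<subseteq> X \<and> card s = 2}"

lemma pair_in_edges [simp]: "{a, b} \<in> edges X \<longleftrightarrow> a \<in> X \<and> b \<in> X \<and> a \<noteq> b"
  by (auto simp: edges_def card_insert_if)

lemma edgesE:
  assumes "s \<in> edges X"
  obtains a b where "s = {a, b}" "a \<noteq> b" "a \<in> X" "b \<in> X"
  using assms by (auto simp: edges_def card_2_iff)

lemma edges_containE:
  assumes "s \<in> edges X" "x \<in> s"
  obtains b where "s = {b, x}" "b \<noteq> x" "b \<in> X"
  using assms by (elim edgesE) auto

lemma top2_in_edges:
  assumes X: "finite X" "2 \<le> card X" and r: "r \<in> orderings X"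
  shows "top2 X r \<in> edges X"
proof -
  have tr: "trans r" "irrefl r" "total_on X r" and sub: "r \<subseteq> X \<times> X"
    using r by (auto simp: orderings_def strict_linear_order_on_def)
  have "finite r" using sub X(1) by (meson finite_SigmaI finite_subset)
  then have "wf r" using tr(1,2) by (simp add: finite_acyclic_wf acyclic_irrefl)
  \<comment> \<open>A minimal element of \<open>Y\<close> for the well-founded \<open>r\<close> has
    nothing of \<open>Y\<close> above it, so by totality it is above the rest. Applied to
    \<open>X\<close> and then to \<open>X - {a}\<close>, this yields the two top ranks.\<close>
  then have top: "\<exists>a\<in>Y. \<forall>y\<in>Y - {a}. (a, y) \<in> r" if "Y \<subseteq> X" "Y \<noteq> {}" for Y
    using that tr(3) unfolding wf_eq_minimal total_on_def by (metis DiffE all_not_in_conv insertI1 subsetD)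
  obtain a where a: "a \<in> X" "\<forall>y\<in>X - {a}. (a, y) \<in> r" using top[of X] X by force
  have "card (X - {a}) > 0" using X a(1) by simp
  then have "X - {a} \<noteq> {}" by (metis card.empty less_irrefl)
  then obtain b where b: "b \<in> X" "b \<noteq> a" "\<forall>y\<in>X - {a} - {b}. (b, y) \<in> r"
    using top[of "X - {a}"] by auto
  have asym: "(y, z) \<notin> r" if "(z, y) \<in> r" for y z
    using that tr(1,2) by (meson irreflD transD)
  have "(y, a) \<notin> r" for y using a asym sub by (cases "y = a") blast+
  moreover have "(y, b) \<in> r \<longleftrightarrow> y = a" if "y \<in> X" for y
    using that a b asym by (cases "y = b") blast+
  ultimately have "top2 X r = {a, b}"
    by (intro top2_eqI) (use X a b in auto)
  then show ?thesis using a b by simp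
qed

lemma fresh_element:
  assumes "finite X" "card X \<ge> 4"
  obtains d where "d \<in> X" "d \<notin> {a, b, c}"
proof -
  have "card {a, b, c} < card X" using card_insert_le_m1[of 3 "{b,c}" a] assms
    by (auto simp: card_insert_if split: if_splits)
  then have "\<not> X \<subseteq> {a, b, c}" using card_mono[of "{a, b, c}" X] by auto
  then show ?thesis using that by blast
qed

text \<open>Isolates the combinatorics from the orderings: \<open>H\<close> stands for
  \<open>G\<close> as a function of the edges. Its codomain is arbitrary because only invariance
  matters.\<close>

locale edge_rule =
  fixes X :: "'a set" and n :: nat and H :: "(nat \<Rightarrow> 'a set) \<Rightarrow> 'b"
  assumes finite_X: "finite X" and card_X: "card X \<ge> 4" and n: "n \<ge> 3"
    and witness: "\<lbrakk>e \<in> {1..n} \<rightarrow>\<^sub>E edges X; i \<in> {1..n}; j \<in> {1..n}; i \<noteq> j; e i = {a, x};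
      {a, y} \<in> edges X; x \<noteq> y; e j = {x, y} \<or> e j \<inter> {x, y} = {}\<rbrakk>
      \<Longrightarrow> H (e(i := {a, y})) = H e"
    and trade: "\<lbrakk>e \<in> {1..n} \<rightarrow>\<^sub>E edges X; i \<in> {1..n}; j \<in> {1..n}; i \<noteq> j; e i = {a, x};
      e j = {b, y}; {a, y} \<in> edges X; {b, x} \<in> edges X; x \<noteq> y\<rbrakk>
      \<Longrightarrow> H (e(i := {a, y}, j := {b, x})) = H e"
begin

section \<open>Replacing one endpoint of an edge\<close>

abbreviation "E \<equiv> {1..n} \<rightarrow>\<^sub>E edges X"

definition disagree :: "(nat \<Rightarrow> 'a set) \<Rightarrow> bool" where
  "disagree e \<longleftrightarrow> \<not> (\<forall>i\<in>{1..n}. \<forall>j\<in>{1..n}. e i = e j)"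

lemma update_in_E: "e \<in> E \<Longrightarrow> i \<in> {1..n} \<Longrightarrow> s \<in> edges X \<Longrightarrow> e(i := s) \<in> E"
  by (auto simp: PiE_iff extensional_def)

lemma E_D: "e \<in> E \<Longrightarrow> i \<in> {1..n} \<Longrightarrow> e i \<in> edges X"
  by auto

text \<open>Here \<open>j\<close> and \<open>k\<close> both hold \<open>x\<close> but not
  \<open>y\<close>, so neither is a witness for the direct move.\<close>

lemma replace_same:
  assumes e: "e \<in> E" and I: "i \<in> {1..n}" "j \<in> {1..n}" "k \<in> {1..n}" "i \<noteq> j" "i \<noteq> k" "j \<noteq> k"
    and v: "e i = {a, x}" "e j = {b, x}" "e k = {c, x}"
    and ne: "{a, y} \<in> edges X" "y \<notin> {b, c, x}" "a \<noteq> b"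
  shows "H (e(i := {a, y})) = H e"
proof -
  have X: "a \<in> X" "b \<in> X" "c \<in> X" "x \<in> X" "y \<in> X" "a \<noteq> x" "b \<noteq> x" "c \<noteq> x" "a \<noteq> y"
    using E_D[OF e I(1)] E_D[OF e I(2)] E_D[OF e I(3)] v ne(1) by auto
  show ?thesis
  proof (cases "b = c")
    case False
    \<comment> \<open>First \<open>j\<close> is a witness, holding both \<open>x\<close> and
      \<open>b\<close>; then \<open>k\<close> is one, holding neither \<open>b\<close> nor
      \<open>y\<close>.\<close>
    let ?f = "e(i := {a, b})"
    have 1: "H ?f = H e"
      using witness[OF e I(1,2,4) v(1), of b] X ne v by (auto simp: insert_commute)
    have "?f \<in> E" by (rule update_in_E[OF e I(1)]) (use X ne in auto)
    from witness[OF this I(1,3,5), of a b y] have "H (?f(i := {a, y})) = H ?f"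
      using X ne v I False by auto
    with 1 show ?thesis by simp
  next
    case True
    \<comment> \<open>With \<open>b = c\<close> the detour through \<open>{a, b}\<close> fails,
      since \<open>k\<close> holds \<open>b\<close> but not \<open>y\<close>. Instead
      \<open>j\<close> moves to \<open>{b, a}\<close> with witness \<open>i\<close>, then
      \<open>i\<close> moves to \<open>{x, y}\<close> with witness \<open>k\<close>, and trading
      \<open>x\<close> against \<open>a\<close> gives \<open>j\<close> its old edge back.\<close>
    let ?f = "e(j := {b, a})" let ?g = "?f(i := {x, y})"
    have 1: "H ?f = H e"
      using witness[OF e I(2,1) _ v(2), of a] X ne v I by (auto simp: insert_commute)
    have f: "?f \<in> E" by (rule update_in_E[OF e I(2)]) (use X ne in auto)
    from witness[OF this I(1,3,5), of x a y] have 2: "H ?g = H ?f"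
      using X ne v I True by (auto simp: insert_commute)
    have g: "?g \<in> E" by (rule update_in_E[OF f I(1)]) (use X ne in auto)
    from trade[OF this I(1,2,4), of y x b a] have "H (?g(i := {y, a}, j := {b, x})) = H ?g"
      using X ne v I True by (auto simp: insert_commute)
    moreover have "?g(i := {y, a}, j := {b, x}) = e(i := {a, y})"
      using v I by (auto simp: fun_eq_iff)
    ultimately show ?thesis using 1 2 by simp
  qed
qed

text \<open>Trading \<open>x\<close> against \<open>c\<close> with \<open>k\<close> brings
  \<open>i\<close> to \<open>{a, c}\<close>. Then \<open>j\<close> witnesses the move to
  \<open>{a, y}\<close>, and finally \<open>i\<close> witnesses the return of \<open>k\<close> to
  its old edge.\<close>

lemma replace_opposite_aligned:
  assumes e: "e \<in> E" and I: "i \<in> {1..n}" "j \<in> {1..n}" "k \<in> {1..n}" "i \<noteq> j" "i \<noteq> k" "j \<noteq> k"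
    and v: "e i = {a, x}" "e j = {a, x}" "e k = {c, y}"
    and ne: "{a, y} \<in> edges X" "x \<noteq> y" "x \<noteq> c" "c \<noteq> a"
  shows "H (e(i := {a, y})) = H e"
proof -
  have X: "a \<in> X" "c \<in> X" "x \<in> X" "y \<in> X" "a \<noteq> x" "c \<noteq> y" "a \<noteq> y"
    using E_D[OF e I(1)] E_D[OF e I(3)] v ne(1) by auto
  let ?f = "e(i := {a, c}, k := {y, x})" let ?g = "?f(i := {a, y})"
  have 1: "H ?f = H e"
    using trade[OF e I(1,3,5) v(1), of y c] X ne v by (auto simp: insert_commute)
  have f: "?f \<in> E"
    by (intro update_in_E e I) (use X ne in auto)
  from witness[OF this I(1,2,4), of a c y] have 2: "H ?g = H ?f"
    using X ne v I by auto
  have g: "?g \<in> E" by (rule update_in_E[OF f I(1)]) (use X ne in auto)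
  from witness[OF this I(3,1), of y x c] have "H (?g(k := {y, c})) = H ?g"
    using X ne v I by auto
  moreover have "?g(k := {y, c}) = e(i := {a, y})" using v I by (auto simp: fun_eq_iff)
  ultimately show ?thesis using 1 2 by simp
qed

text \<open>Each of \<open>j\<close> and \<open>k\<close> holds exactly one of \<open>x\<close>,
  \<open>y\<close>, so neither is a witness for the direct move. The detour depends on which of
  \<open>b\<close>, \<open>c\<close> equals \<open>a\<close>.\<close>

lemma replace_opposite:
  assumes e: "e \<in> E" and I: "i \<in> {1..n}" "j \<in> {1..n}" "k \<in> {1..n}" "i \<noteq> j" "i \<noteq> k" "j \<noteq> k"
    and v: "e i = {a, x}" "e j = {b, x}" "e k = {c, y}"
    and ne: "{a, y} \<in> edges X" "x \<noteq> y" "x \<noteq> c" "y \<noteq> b"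
  shows "H (e(i := {a, y})) = H e"
proof -
  have X: "a \<in> X" "b \<in> X" "c \<in> X" "x \<in> X" "y \<in> X" "a \<noteq> x" "b \<noteq> x" "c \<noteq> y" "a \<noteq> y"
    using E_D[OF e I(1)] E_D[OF e I(2)] E_D[OF e I(3)] v ne(1) by auto
  consider "b \<noteq> a" "c \<noteq> a" | "b = a" "c = a" | "b = a" "c \<noteq> a" | "b \<noteq> a" "c = a" by blast
  then show ?thesis
  proof cases
    case 1
    \<comment> \<open>Replace \<open>a\<close> by \<open>y\<close> first, then \<open>x\<close> by
      \<open>a\<close>: \<open>j\<close> holds neither \<open>a\<close> nor \<open>y\<close>, and
      \<open>k\<close> holds neither \<open>x\<close> nor \<open>a\<close>.\<close>
    let ?f = "e(i := {x, y})"
    have 2: "H ?f = H e"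
      using witness[OF e I(1,2,4), of x a y] X ne v 1 by (auto simp: insert_commute)
    have "?f \<in> E" by (rule update_in_E[OF e I(1)]) (use X ne in auto)
    from witness[OF this I(1,3,5), of y x a] have "H (?f(i := {y, a})) = H ?f"
      using X ne v I 1 by (auto simp: insert_commute)
    with 2 show ?thesis by (simp add: insert_commute)
  next
    case 2
    \<comment> \<open>Detour through a fourth alternative: \<open>k\<close> holds neither
      \<open>x\<close> nor \<open>d\<close>, and \<open>j\<close> holds neither \<open>d\<close> nor
      \<open>y\<close>. The bound on \<open>card X\<close> enters here.\<close>
    obtain d where d: "d \<in> X" "d \<notin> {x, y, a}" using fresh_element[OF finite_X card_X] .
    let ?f = "e(i := {a, d})"
    have 1: "H ?f = H e"
      using witness[OF e I(1,3,5) v(1), of d] X ne v 2 d by auto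
    have "?f \<in> E" by (rule update_in_E[OF e I(1)]) (use X ne d in auto)
    from witness[OF this I(1,2,4), of a d y] have "H (?f(i := {a, y})) = H ?f"
      using X ne v I 2 d by auto
    with 1 show ?thesis by simp
  next
    case 3
    then show ?thesis using replace_opposite_aligned[OF e I, of a x c y] v ne by simp
  next
    case 4
    \<comment> \<open>Read backwards, this is the aligned case with \<open>x\<close>,
      \<open>y\<close> and \<open>j\<close>, \<open>k\<close> exchanged.\<close>
    let ?e = "e(i := {a, y})"
    have "?e \<in> E" by (rule update_in_E[OF e I(1)]) (use X ne in auto)
    from replace_opposite_aligned[OF this I(1,3,2,5,4), of a y b x]
    have "H (?e(i := {a, x})) = H ?e" using 4 v ne X I by auto
    moreover have "?e(i := {a, x}) = e" using v by (auto simp: fun_eq_iff)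
    ultimately show ?thesis by simp
  qed
qed

lemma third_individual:
  obtains k where "k \<in> {1..n}" "k \<noteq> i" "k \<noteq> j"
proof -
  have "card {i, j} \<le> 2" by (simp add: card_insert_if)
  then have "\<not> {1..n} \<subseteq> {i, j}" using card_mono[of "{i, j}" "{1..n}"] n by auto
  then show ?thesis using that by blast
qed

lemma replace_uniform:
  assumes e: "e \<in> E" and i: "i \<in> {1..n}" "e i = {a, x}" and y: "{a, y} \<in> edges X" "x \<noteq> y"
    and dis: "disagree e"
    and all: "\<And>j. j \<in> {1..n} \<Longrightarrow> j \<noteq> i \<Longrightarrow> x \<in> e j \<and> y \<notin> e j"
  shows "H (e(i := {a, y})) = H e"
proof -
  \<comment> \<open>Disagreement supplies the inequality of \<open>a\<close> and \<open>b\<close>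
    required by \<open>replace_same\<close>.\<close>
  obtain j where j: "j \<in> {1..n}" "e j \<noteq> e i" using dis i(1) unfolding disagree_def by metis
  then have ji: "j \<noteq> i" by auto
  obtain k where k: "k \<in> {1..n}" "k \<noteq> i" "k \<noteq> j" by (rule third_individual)
  obtain b where b: "e j = {b, x}" using edges_containE E_D[OF e j(1)] all[OF j(1) ji] by metis
  obtain c where c: "e k = {c, x}" using edges_containE E_D[OF e k(1)] all[OF k(1,2)] by metis
  show ?thesis
    using replace_same[OF e i(1) j(1) k(1) _ _ _ i(2) b c y(1)] ji k j(2) i(2) b c y
      all[OF j(1) ji] all[OF k(1,2)] by auto
qed

text \<open>Without a witness the others all hold \<open>x\<close>, all hold \<open>y\<close>, or
  are mixed. The second case is the first read backwards, so disagreement is needed after the move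
  as well as before.\<close>

lemma replace_endpoint:
  assumes e: "e \<in> E" and i: "i \<in> {1..n}" "e i = {a, x}" and y: "{a, y} \<in> edges X" "x \<noteq> y"
    and dis: "disagree e" "disagree (e(i := {a, y}))"
  shows "H (e(i := {a, y})) = H e"
proof (cases "\<exists>j\<in>{1..n} - {i}. e j = {x, y} \<or> e j \<inter> {x, y} = {}")
  case True
  then show ?thesis using witness[OF e i(1) _ _ i(2) y] by blast
next
  case False
  have one: "x \<in> e j \<longleftrightarrow> y \<notin> e j" if j: "j \<in> {1..n}" "j \<noteq> i" for j
  proof -
    have "e j \<noteq> {x, y}" "e j \<inter> {x, y} \<noteq> {}" using False j by blast+
    moreover obtain p q where "e j = {p, q}" using E_D[OF e j(1)] by (rule edgesE)
    ultimately show ?thesis using y(2) by auto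
  qed
  let ?e = "e(i := {a, y})"
  have X: "a \<in> X" "x \<in> X" "a \<noteq> x" using E_D[OF e i(1)] i(2) by auto
  consider "\<forall>j\<in>{1..n} - {i}. x \<in> e j" | "\<forall>j\<in>{1..n} - {i}. y \<in> e j"
    | j k where "j \<in> {1..n} - {i}" "k \<in> {1..n} - {i}" "x \<in> e j" "y \<in> e k"
    using one by blast
  then show ?thesis
  proof cases
    case 1
    then show ?thesis using replace_uniform[OF e i y dis(1)] one by blast
  next
    case 2
    have "?e \<in> E" by (rule update_in_E[OF e i(1) y(1)])
    from replace_uniform[OF this i(1) _ _ _ dis(2), of a y x]
    have "H (?e(i := {a, x})) = H ?e" using 2 one X y by auto
    moreover have "?e(i := {a, x}) = e" using i by (auto simp: fun_eq_iff)
    ultimately show ?thesis by simp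
  next
    case 3
    then have J: "j \<in> {1..n}" "j \<noteq> i" and K: "k \<in> {1..n}" "k \<noteq> i" by auto
    obtain b where b: "e j = {b, x}" using edges_containE E_D[OF e J(1)] 3(3) by metis
    obtain c where c: "e k = {c, y}" using edges_containE E_D[OF e K(1)] 3(4) by metis
    show ?thesis
      using replace_opposite[OF e i(1) J(1) K(1) _ _ _ i(2) b c y] J K b c one[OF J] one[OF K] by auto
  qed
qed

section \<open>Connecting the disagreement profiles\<close>

text \<open>Edges with a common vertex differ by one endpoint replacement. Disjoint edges need two,
  and the edge in between must not create unanimity.\<close>

lemma change_edge:
  assumes e: "e \<in> E" and i: "i \<in> {1..n}" and s: "s \<in> edges X"
    and dis: "disagree e" "disagree (e(i := s))"
  shows "H (e(i := s)) = H e"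
proof (cases "e i \<inter> s = {}")
  case False
  then obtain a where a: "a \<in> e i" "a \<in> s" by blast
  obtain x where x: "e i = {a, x}" using edges_containE E_D[OF e i] a(1) by (metis insert_commute)
  obtain y where y: "s = {a, y}" using edges_containE s a(2) by (metis insert_commute)
  show ?thesis
  proof (cases "x = y")
    case True
    then show ?thesis using x y by (metis fun_upd_triv)
  next
    case False
    then show ?thesis using replace_endpoint[OF e i x _ False] s dis y by simp
  qed
next
  case True
  obtain a x where x: "e i = {a, x}" "a \<noteq> x" "a \<in> X" "x \<in> X" using E_D[OF e i] by (rule edgesE)
  obtain z w where z: "s = {z, w}" "z \<noteq> w" "z \<in> X" "w \<in> X" using s by (rule edgesE)
  have d: "a \<noteq> z" "a \<noteq> w" "x \<noteq> z" "x \<noteq> w" using True x z by auto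
  obtain j where j: "j \<in> {1..n}" "j \<noteq> i" by (rule third_individual)
  \<comment> \<open>Two candidate edges for the intermediate step; at most one creates unanimity.\<close>
  have "e j \<noteq> {a, z} \<or> e j \<noteq> {a, w}"
    using d z(2) by (metis doubleton_eq_iff)
  then obtain t t' where t: "t \<in> X" "t \<noteq> a" "t \<noteq> x" "s = {t, t'}" "t \<noteq> t'" "t' \<in> X" "a \<noteq> t'"
    and tj: "e j \<noteq> {a, t}"
  proof
    assume "e j \<noteq> {a, z}"
    then show thesis by (intro that[of z w]) (use z d in auto)
  next
    assume "e j \<noteq> {a, w}"
    then show thesis by (intro that[of w z]) (use z d in auto)
  qed
  let ?f = "e(i := {a, t})"
  have f: "?f \<in> E" by (rule update_in_E[OF e i]) (use x t in auto)
  have disf: "disagree ?f"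
    unfolding disagree_def using i j tj by (metis fun_upd_other fun_upd_same)
  have 1: "H ?f = H e"
    using replace_endpoint[OF e i x(1) _ _ dis(1) disf] x t by auto
  have "H (?f(i := {t, t'})) = H ?f"
    using replace_endpoint[OF f i, of t a t'] disf dis(2) x t by (auto simp: insert_commute)
  then show ?thesis using 1 t(4) by simp
qed

text \<open>Induction on the number of individuals whose edges differ. It suffices to move either
  \<open>e\<close> towards \<open>f\<close> or \<open>f\<close> towards \<open>e\<close> at one
  individual while keeping disagreement.\<close>

theorem constant_on_disagreement:
  assumes "e \<in> E" "f \<in> E" "disagree e" "disagree f"
  shows "H e = H f"
  using assms
proof (induction "card {i \<in> {1..n}. e i \<noteq> f i}" arbitrary: e f rule: less_induct)
  case less
  note e = less.prems(1) and f = less.prems(2)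
  show ?case
  proof (cases "e = f")
    case False
    let ?D = "{l \<in> {1..n}. e l \<noteq> f l}"
    have smaller: "card {l \<in> {1..n}. (e(i := f i)) l \<noteq> f l} < card ?D"
      "card {l \<in> {1..n}. e l \<noteq> (f(i := e i)) l} < card ?D"
      if "i \<in> {1..n}" "e i \<noteq> f i" for i
    proof -
      have "{l \<in> {1..n}. (e(i := f i)) l \<noteq> f l} = ?D - {i}"
        "{l \<in> {1..n}. e l \<noteq> (f(i := e i)) l} = ?D - {i}"
        by (auto split: if_splits)
      moreover have "card (?D - {i}) < card ?D" using that by (intro card_Diff1_less) auto
      ultimately show "card {l \<in> {1..n}. (e(i := f i)) l \<noteq> f l} < card ?D"
        "card {l \<in> {1..n}. e l \<noteq> (f(i := e i)) l} < card ?D"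
        by (simp_all only:)
    qed
    have "\<exists>i\<in>{1..n}. e i \<noteq> f i \<and> (disagree (e(i := f i)) \<or> disagree (f(i := e i)))"
    proof (rule ccontr)
      assume no: "\<not> ?thesis"
      from False obtain i where i: "i \<in> {1..n}" "e i \<noteq> f i"
        using e f by (metis PiE_ext)
      \<comment> \<open>Both changes at \<open>i\<close> lead to unanimity, so off \<open>i\<close>
        the profile \<open>e\<close> is constantly \<open>f i\<close> and \<open>f\<close> is
        constantly \<open>e i\<close>.\<close>
      have ef: "e l = f i" "f l = e i" if "l \<in> {1..n}" "l \<noteq> i" for l
        using no i that unfolding disagree_def by (metis fun_upd_apply)+
      obtain j where j: "j \<in> {1..n}" "j \<noteq> i" by (rule third_individual)
      obtain k where k: "k \<in> {1..n}" "k \<noteq> i" "k \<noteq> j" by (rule third_individual)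
      \<comment> \<open>Changing \<open>j\<close> instead gives \<open>j\<close> the edge
        \<open>e i\<close>, while \<open>k\<close> keeps the different edge
        \<open>f i\<close>.\<close>
      have "disagree (e(j := f j))"
        unfolding disagree_def using ef[OF j] ef[OF k(1,2)] i j k
        by (metis fun_upd_other fun_upd_same)
      then show False using no j ef[OF j] i by metis
    qed
    then obtain i where i: "i \<in> {1..n}" "e i \<noteq> f i"
      and "disagree (e(i := f i)) \<or> disagree (f(i := e i))" by blast
    from this(3) show ?thesis
    proof
      assume d: "disagree (e(i := f i))"
      have "H (e(i := f i)) = H f"
        using less.hyps[OF smaller(1)[OF i]] update_in_E[OF e i(1) E_D[OF f i(1)]] f d less.prems
        by blast
      then show ?thesis using change_edge[OF e i(1) E_D[OF f i(1)] less.prems(3) d] by simp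
    next
      assume d: "disagree (f(i := e i))"
      have "H e = H (f(i := e i))"
        using less.hyps[OF smaller(2)[OF i]] update_in_E[OF f i(1) E_D[OF e i(1)]] e d less.prems
        by blast
      then show ?thesis using change_edge[OF f i(1) E_D[OF e i(1)] less.prems(4) d] by simp
    qed
  qed simp
qed

end

section \<open>Reduction to edge profiles\<close>

text \<open>One individual's half of a transposition pair, seen through top-two sets. The ordering
  is existential because top-2-only allows any ordering behind a given edge.\<close>

definition edge_shift :: "'a set \<Rightarrow> 'a \<Rightarrow> 'a \<Rightarrow> 'a set \<Rightarrow> 'a set \<Rightarrow> bool" where
  "edge_shift X x y s t \<longleftrightarrow> (\<exists>r\<in>orderings X. swap_alternatives x y r \<in> orderings X \<and>
     immediately_above r x y \<and> top2 X r = s \<and> top2 X (swap_alternatives x y r) = t)"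

lemma edge_shift_list:
  assumes "distinct (p @ x # y # q)" "set (p @ x # y # q) = X"
    and "p @ x # y # q = a # b # l" "p @ y # x # q = a' # b' # l'"
  shows "edge_shift X x y {a, b} {a', b'}"
proof -
  let ?r = "list_order (p @ x # y # q)"
  have d: "distinct (p @ y # x # q)" "set (p @ y # x # q) = X" using assms(1,2) by auto
  have "?r \<in> orderings X" "list_order (p @ y # x # q) \<in> orderings X"
    using list_order_in_orderings assms(1,2) d by blast+
  moreover have "top2 X ?r = {a, b}" "top2 X (list_order (p @ y # x # q)) = {a', b'}"
    using top2_list_order assms d by metis+
  ultimately show ?thesis
    unfolding edge_shift_def
    using swap_list_order[OF assms(1)] immediately_above_list_order[OF assms(1)] by metis
qed

context
  fixes X :: "'a set"
  assumes X: "finite X"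
begin

lemma edge_shift_endpoint:
  assumes "{a, x} \<in> edges X" "{a, y} \<in> edges X" "x \<noteq> y"
  shows "edge_shift X x y {a, x} {a, y}"
proof -
  obtain q where "set q = X - {a, x, y}" "distinct q" using X finite_distinct_list by blast
  \<comment> \<open>With \<open>a\<close> on top, \<open>x\<close> and \<open>y\<close> in ranks two
    and three trade places.\<close>
  then show ?thesis using assms by (intro edge_shift_list[where p = "[a]" and q = q]) auto
qed

text \<open>The pair \<open>x\<close>, \<open>y\<close> occupies either the top two ranks or ranks
  three and four, so its swap leaves the top-two set alone.\<close>

lemma edge_shift_invisible:
  assumes "s \<in> edges X" "x \<noteq> y" "x \<in> X" "y \<in> X" "s = {x, y} \<or> s \<inter> {x, y} = {}"
  shows "edge_shift X x y s s"
proof (cases "s = {x, y}")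
  case True
  obtain q where "set q = X - {x, y}" "distinct q" using X finite_distinct_list by blast
  then have "edge_shift X x y {x, y} {y, x}"
    using assms by (intro edge_shift_list[where p = "[]" and q = q]) auto
  then show ?thesis using True by (simp add: insert_commute)
next
  case False
  obtain a b where s: "s = {a, b}" "a \<noteq> b" "a \<in> X" "b \<in> X" using assms(1) by (rule edgesE)
  obtain q where "set q = X - {a, b, x, y}" "distinct q" using X finite_distinct_list by blast
  then show ?thesis unfolding s(1) using assms False s
    by (intro edge_shift_list[where p = "[a, b]" and q = q]) auto
qed

lemma ordering_with_top2:
  assumes "s \<in> edges X"
  shows "\<exists>r\<in>orderings X. top2 X r = s"
proof -
  obtain a b where s: "s = {a, b}" "a \<noteq> b" "a \<in> X" "b \<in> X" using assms by (rule edgesE)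
  obtain q where "set q = X - {a, b}" "distinct q" using X finite_distinct_list by blast
  then have "distinct (a # b # q)" "set (a # b # q) = X" using s by auto
  then show ?thesis using top2_list_order list_order_in_orderings s(1) by metis
qed

end

theorem theorem3:
  fixes X :: "'a set" and n :: nat and G :: "(nat \<Rightarrow> 'a rel) \<Rightarrow> 'a set"
  assumes "finite X" and "card X \<ge> 4" and "n \<ge> 3"
    and "social_choice_correspondence X n G"
    and "balanced X n G"
    and "top2_only X n G"
  shows "\<forall>u \<in> disagreement_profiles X n. \<forall>v \<in> disagreement_profiles X n. G u = G v"
proof -
  \<comment> \<open>\<open>ord\<close> picks a representative ordering for each edge; by top-2-only
    the choice does not affect \<open>H\<close>.\<close>
  define ord where "ord s = (SOME r. r \<in> orderings X \<and> top2 X r = s)" for s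
  define H where "H e = G (\<lambda>i\<in>{1..n}. ord (e i))" for e
  have ord: "ord s \<in> orderings X" "top2 X (ord s) = s" if "s \<in> edges X" for s
    using someI_ex[OF ordering_with_top2[OF assms(1) that, unfolded Bex_def]] by (auto simp: ord_def)
  have G_eq: "G u = H e" if "u \<in> profiles X n" "e \<in> {1..n} \<rightarrow>\<^sub>E edges X"
    "\<And>i. i \<in> {1..n} \<Longrightarrow> top2 X (u i) = e i" for u e
  proof -
    let ?w = "\<lambda>i\<in>{1..n}. ord (e i)"
    have "?w \<in> profiles X n"
      using ord that(2) by (auto simp: profiles_def)
    moreover have "top2 X (u i) = top2 X (?w i)" if i: "i \<in> {1..n}" for i
      using ord(2)[of "e i"] PiE_mem[OF \<open>e \<in> _\<close> i] \<open>\<And>i. i \<in> {1..n} \<Longrightarrow> top2 X (u i) = e i\<close>[OF i] i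
      by simp
    ultimately show ?thesis
      using assms(6) \<open>u \<in> profiles X n\<close> unfolding top2_only_def H_def by blast
  qed
  have shift: "H (e(i := s', j := t')) = H e"
    if e: "e \<in> {1..n} \<rightarrow>\<^sub>E edges X" and I: "i \<in> {1..n}" "j \<in> {1..n}" "i \<noteq> j"
      and st: "s' \<in> edges X" "t' \<in> edges X"
      and sh: "edge_shift X x y (e i) s'" "edge_shift X y x (e j) t'" for e i j s' t' x y
  proof -
    obtain r where r: "r \<in> orderings X" "swap_alternatives x y r \<in> orderings X"
      "immediately_above r x y" "top2 X r = e i" "top2 X (swap_alternatives x y r) = s'"
      using sh(1) by (auto simp: edge_shift_def)
    obtain q where q: "q \<in> orderings X" "swap_alternatives y x q \<in> orderings X"
      "immediately_above q y x" "top2 X q = e j" "top2 X (swap_alternatives y x q) = t'"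
      using sh(2) by (auto simp: edge_shift_def)
    \<comment> \<open>\<open>transposition_pair\<close> writes the swap as \<open>x y\<close> for
      both individuals, whereas the shift of \<open>j\<close> is stated with
      \<open>y x\<close>.\<close>
    have swap: "swap_alternatives x y q = swap_alternatives y x q"
      by (simp add: swap_alternatives_def transpose_commute)
    have eE: "e l \<in> edges X" if "l \<in> {1..n}" for l using e that by (rule PiE_mem)
    \<comment> \<open>Replacing the representatives of \<open>i\<close> and \<open>j\<close> by
      \<open>r\<close> and \<open>q\<close> keeps all edges but makes the transposition
      available.\<close>
    define u where "u = (\<lambda>l\<in>{1..n}. ord (e l))(i := r, j := q)"
    define v where "v = u(i := swap_alternatives x y (u i), j := swap_alternatives x y (u j))"
    have uv: "u \<in> profiles X n" "v \<in> profiles X n"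
      using ord e r q I swap unfolding u_def v_def profiles_def
      by (auto simp: PiE_iff extensional_def)
    have "transposition_pair n u x y i j v"
      using r q I by (auto simp: transposition_pair_def u_def v_def)
    then have "G v = G u" using assms(5) uv unfolding balanced_def by blast
    moreover have "G u = H e"
      by (rule G_eq[OF uv(1) e]) (use r q in \<open>auto simp: u_def ord eE\<close>)
    moreover have "G v = H (e(i := s', j := t'))"
    proof (rule G_eq[OF uv(2)])
      show "e(i := s', j := t') \<in> {1..n} \<rightarrow>\<^sub>E edges X"
        using e I st by (auto simp: PiE_iff extensional_def)
    qed (use r q I swap in \<open>auto simp: u_def v_def ord eE\<close>)
    ultimately show ?thesis by simp
  qed
  interpret edge_rule X n H
  proof
    fix e i j a x y
    assume e: "e \<in> {1..n} \<rightarrow>\<^sub>E edges X" and I: "i \<in> {1..n}" "j \<in> {1..n}" "i \<noteq> j"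
      and v: "e i = {a, x}" "{a, y} \<in> edges X" "x \<noteq> y" "e j = {x, y} \<or> e j \<inter> {x, y} = {}"
    have ij: "{a, x} \<in> edges X" "e j \<in> edges X" using e I v(1) by (metis PiE_mem)+
    have "edge_shift X x y (e i) {a, y}" using edge_shift_endpoint[OF assms(1) ij(1) v(2,3)] v(1) by simp
    moreover have "edge_shift X y x (e j) (e j)"
      by (rule edge_shift_invisible[OF assms(1) ij(2)]) (use v ij in auto)
    \<comment> \<open>The invisible swap of \<open>j\<close> appears as an update of
      \<open>j\<close> by its own edge.\<close>
    ultimately have "H (e(i := {a, y}, j := e j)) = H e" using shift[OF e I v(2) ij(2)] by blast
    moreover have "e(i := {a, y}, j := e j) = e(i := {a, y})" using I by (auto simp: fun_eq_iff)
    ultimately show "H (e(i := {a, y})) = H e" by simp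
  next
    fix e i j a x b y
    assume e: "e \<in> {1..n} \<rightarrow>\<^sub>E edges X" and I: "i \<in> {1..n}" "j \<in> {1..n}" "i \<noteq> j"
      and v: "e i = {a, x}" "e j = {b, y}" "{a, y} \<in> edges X" "{b, x} \<in> edges X" "x \<noteq> y"
    have ij: "{a, x} \<in> edges X" "{b, y} \<in> edges X" using e I v(1,2) by (metis PiE_mem)+
    show "H (e(i := {a, y}, j := {b, x})) = H e"
      using shift[OF e I v(3,4)] edge_shift_endpoint[OF assms(1) ij(1) v(3,5)]
        edge_shift_endpoint[OF assms(1) ij(2) v(4) v(5)[symmetric]] v(1,2) by simp
  qed (use assms in auto)
  have key: "(\<lambda>i\<in>{1..n}. top2 X (u i)) \<in> E" "disagree (\<lambda>i\<in>{1..n}. top2 X (u i))"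
    "G u = H (\<lambda>i\<in>{1..n}. top2 X (u i))" if "u \<in> disagreement_profiles X n" for u
  proof -
    have u: "u \<in> profiles X n" using that by (simp add: disagreement_profiles_def)
    show E: "(\<lambda>i\<in>{1..n}. top2 X (u i)) \<in> E"
      using u top2_in_edges[OF assms(1)] assms(2) by (auto simp: profiles_def)
    show "disagree (\<lambda>i\<in>{1..n}. top2 X (u i))"
      using that by (auto simp: disagreement_profiles_def disagree_def)
    show "G u = H (\<lambda>i\<in>{1..n}. top2 X (u i))" by (rule G_eq[OF u E]) simp
  qed
  show ?thesis using constant_on_disagreement key by metis
qed

end
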